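(* Let $(a_n)_{n\ge 0}$ be a nearly linear recurrence sequence whose characteristic polynomial $P(x)=x^d+A_{d-1}x^{d-1}+\cdots+A_0$ is separable, and let its zeros $\alpha_1,\dots,\alpha_d$ be ordered as $$|\alpha_1|\ge \dots \ge |\alpha_{r_1}|> 1 = |\alpha_{r_1+1}| =\dots =|\alpha_{r_1+r_2}|,$$ where $r_1+r_2=d$. Write $\tilde a_n=\sum_{j=1}^d \tilde g_j\alpha_j^n$ and $\hat a_n=\sum_{j=1}^d \hat g_j\alpha_j^n$ (with constants $\tilde g_j,\hat g_j$) for the linear recurrence sequences $(\tilde a_n)$, $(\hat a_n)$ defined below. Then: (i) if $r_1>0$ and $r_2=0$, then $a_n = \sum_{i=1}^{r_1}(\tilde{g}_i+\hat{g}_i c(\alpha_i)) \alpha_i^n +O(1)$, and $\tilde{g}_i+\hat{g}_i c(\alpha_i)\neq 0$ for $i=1,\dots,r_1$; (ii) if $r_1>0$ and $r_2>0$, then $a_n = \sum_{i=1}^{r_1}(\tilde{g}_i+\hat{g}_i c(\alpha_i)) \alpha_i^n +O(n)$, and $\tilde{g}_i+\hat{g}_i c(\alpha_i)\neq 0$ for $i=1,\dots,r_1$; (iii) if $r_1=0$ and $r_2>0$, then $a_n=O(n)$.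
   Context: A sequence $(a_n)_{n\ge 0}$ of complex numbers is a nearly linear recurrence sequence (nlrs) if there exist an integer $d\ge 0$ and complex numbers $A_0,\dots,A_{d-1}$ such that the sequence $(a_{n+d}+A_{d-1}a_{n+d-1}+\cdots+A_0a_n)_{n\ge 0}$ is bounded. For an nlrs, the set of polynomials $B_tx^t+\cdots+B_0\in\mathbb{C}[x]$ such that $(\sum_{i=0}^t B_ia_{n+i})_{n\ge 0}$ is bounded is an ideal of $\mathbb{C}[x]$; its unique monic generator is the characteristic polynomial of $(a_n)$. With $P(x)=x^d+A_{d-1}x^{d-1}+\cdots+A_0$ the characteristic polynomial, the error sequence $(e_n)$ is defined by $e_0=\dots=e_{d-1}=0$ and $e_{n+d}=a_{n+d}+A_{d-1}a_{n+d-1}+\cdots+A_0a_n$ for $n\ge 0$; it is bounded. Put $c(z)=\sum_{j=1}^\infty e_{d+j-1}z^{-j}$, which converges for $|z|>1$. The sequence $(\hat a_n)$ is the linear recurrence sequence with $\hat a_0=\dots=\hat a_{d-2}=0$, $\hat a_{d-1}=1$ and $\hat a_{n+d}+A_{d-1}\hat a_{n+d-1}+\cdots+A_0\hat a_n=0$ for $n\ge 0$; $(\tilde a_n)$ satisfies the same recursion with initial terms $\tilde a_j=a_j$ for $j=0,\dots,d-1$. The $O$-terms refer to $n\to\infty$ (i.e. bounded by a constant times $1$, resp. $n$, for all $n\ge 1$). *)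

theory Defs
  imports "HOL-Analysis.Analysis" "HOL-Computational_Algebra.Polynomial"
    "HOL-Library.Landau_Symbols"
begin

definition nlrs :: "(nat \<Rightarrow> complex) \<Rightarrow> bool" where
  "nlrs a \<longleftrightarrow> (\<exists>(d::nat) (A :: nat \<Rightarrow> complex). Bseq (\<lambda>n. a (n + d) + (\<Sum>i<d. A i * a (n + i))))"

definition shift_eval :: "complex poly \<Rightarrow> (nat \<Rightarrow> complex) \<Rightarrow> nat \<Rightarrow> complex" where
  "shift_eval B a n = (\<Sum>i\<le>degree B. coeff B i * a (n + i))"

definition nlrs_ideal :: "(nat \<Rightarrow> complex) \<Rightarrow> complex poly set" where
  "nlrs_ideal a = {B. Bseq (shift_eval B a)}"

definition is_monic_generator :: "complex poly \<Rightarrow> complex poly set \<Rightarrow> bool" where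
  "is_monic_generator P I \<longleftrightarrow> lead_coeff P = 1 \<and> I = {B. P dvd B}"

definition nlrs_char_poly :: "(nat \<Rightarrow> complex) \<Rightarrow> complex poly" where
  "nlrs_char_poly a = (THE P. is_monic_generator P (nlrs_ideal a))"

text \<open>
  For monic \<open>P\<close> of degree \<open>d\<close>, the linear recurrence sequence with initial terms
  \<open>u 0, \<dots>, u (d - 1)\<close> and characteristic polynomial \<open>P\<close>; the values \<open>u n\<close> with \<open>n \<ge> d\<close> are ignored.
\<close>

function lrs :: "complex poly \<Rightarrow> (nat \<Rightarrow> complex) \<Rightarrow> nat \<Rightarrow> complex" where
  "lrs P u n = (if n < degree P then u n
     else - (\<Sum>i<degree P. coeff P i * lrs P u (n - degree P + i)))"
  by pat_completeness auto
termination
  by (relation "Wellfounded.measure (\<lambda>(P, u, n). n)") auto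

declare lrs.simps [simp del]

definition error_seq :: "(nat \<Rightarrow> complex) \<Rightarrow> nat \<Rightarrow> complex" where
  "error_seq a n = (let P = nlrs_char_poly a; d = degree P in
     if n < d then 0 else a n + (\<Sum>i<d. coeff P i * a (n - d + i)))"

text \<open>\<open>c(z) = \<Sum>j\<ge>1. e\<^sub>d\<^sub>+\<^sub>j\<^sub>-\<^sub>1 z\<^sup>-\<^sup>j\<close>, with the summation index shifted to start at 0.\<close>

definition error_series :: "(nat \<Rightarrow> complex) \<Rightarrow> complex \<Rightarrow> complex" where
  "error_series a z = (\<Sum>j. error_seq a (degree (nlrs_char_poly a) + j) * inverse z ^ Suc j)"

definition tilde_seq :: "(nat \<Rightarrow> complex) \<Rightarrow> nat \<Rightarrow> complex" where
  "tilde_seq a = lrs (nlrs_char_poly a) a"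

definition hat_seq :: "(nat \<Rightarrow> complex) \<Rightarrow> nat \<Rightarrow> complex" where
  "hat_seq a = lrs (nlrs_char_poly a)
     (\<lambda>j. if j = degree (nlrs_char_poly a) - 1 then 1 else 0)"

lemma lrs_init: "n < degree P \<Longrightarrow> lrs P u n = u n"
  by (simp add: lrs.simps)

lemma lrs_rec:
  "lrs P u (n + degree P) + (\<Sum>i<degree P. coeff P i * lrs P u (n + i)) = 0"
  by (subst lrs.simps) simp

lemma shift_eval_bound:
  assumes "degree B \<le> N"
  shows "shift_eval B a n = (\<Sum>i\<le>N. coeff B i * a (n + i))"
  unfolding shift_eval_def
  by (rule sum.mono_neutral_left) (use assms in \<open>auto simp: coeff_eq_0\<close>)

lemma shift_eval_split:
  "shift_eval B a n = lead_coeff B * a (n + degree B) + (\<Sum>i<degree B. coeff B i * a (n + i))"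
proof -
  have "{..degree B} = insert (degree B) {..<degree B}" by auto
  then show ?thesis by (simp add: shift_eval_def)
qed

lemma shift_eval_add: "shift_eval (B + C) a n = shift_eval B a n + shift_eval C a n"
proof -
  define N where "N = max (degree B) (degree C)"
  have "degree (B + C) \<le> N" "degree B \<le> N" "degree C \<le> N"
    by (auto simp: N_def degree_add_le_max)
  then show ?thesis
    by (simp add: shift_eval_bound[of _ N] sum.distrib algebra_simps)
qed

lemma shift_eval_smult: "shift_eval (smult c B) a n = c * shift_eval B a n"
  by (simp add: shift_eval_bound[of "smult c B" "degree B"] degree_smult_le
      shift_eval_def sum_distrib_left mult.assoc)

lemma shift_eval_pCons_0: "shift_eval (pCons 0 B) a n = shift_eval B a (Suc n)"
proof -
  have "shift_eval (pCons 0 B) a n = (\<Sum>i\<le>Suc (degree B). coeff (pCons 0 B) i * a (n + i))"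
    by (rule shift_eval_bound) (rule degree_pCons_le)
  also have "\<dots> = shift_eval B a (Suc n)"
    by (simp add: sum.atMost_Suc_shift shift_eval_def del: sum.atMost_Suc)
  finally show ?thesis .
qed

lemma nlrs_ideal_0: "0 \<in> nlrs_ideal a"
  by (simp add: nlrs_ideal_def shift_eval_def[abs_def])

lemma nlrs_ideal_add:
  assumes "B \<in> nlrs_ideal a" "C \<in> nlrs_ideal a"
  shows "B + C \<in> nlrs_ideal a"
proof -
  have "shift_eval (B + C) a = (\<lambda>n. shift_eval B a n + shift_eval C a n)"
    by (rule ext) (rule shift_eval_add)
  moreover obtain K L where "\<And>n. norm (shift_eval B a n) \<le> K" "\<And>n. norm (shift_eval C a n) \<le> L"
    using assms unfolding nlrs_ideal_def Bseq_def by blast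
  then have "Bseq (\<lambda>n. shift_eval B a n + shift_eval C a n)"
    by (intro BseqI'[of _ "K + L"] norm_triangle_mono)
  ultimately show ?thesis
    by (simp add: nlrs_ideal_def)
qed

lemma nlrs_ideal_smult:
  assumes "B \<in> nlrs_ideal a"
  shows "smult c B \<in> nlrs_ideal a"
proof -
  have "shift_eval (smult c B) a = (\<lambda>n. c * shift_eval B a n)"
    by (rule ext) (rule shift_eval_smult)
  with assms show ?thesis
    by (auto simp: nlrs_ideal_def intro!: Bseq_mult)
qed

lemma nlrs_ideal_pCons_0:
  assumes "B \<in> nlrs_ideal a"
  shows "pCons 0 B \<in> nlrs_ideal a"
proof -
  have "shift_eval (pCons 0 B) a = (\<lambda>n. shift_eval B a (Suc n))"
    by (rule ext) (rule shift_eval_pCons_0)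
  with assms show ?thesis
    by (simp add: nlrs_ideal_def Bseq_Suc_iff)
qed

lemma nlrs_ideal_mult:
  assumes "B \<in> nlrs_ideal a"
  shows "C * B \<in> nlrs_ideal a"
proof (induction C)
  case 0
  then show ?case by (simp add: nlrs_ideal_0)
next
  case (pCons c C)
  then show ?case
    using assms by (simp add: nlrs_ideal_add nlrs_ideal_smult nlrs_ideal_pCons_0)
qed

lemma nlrs_iff_monic: "nlrs a \<longleftrightarrow> (\<exists>B \<in> nlrs_ideal a. lead_coeff B = 1)"
proof
  assume "nlrs a"
  then obtain d A where bd: "Bseq (\<lambda>n. a (n + d) + (\<Sum>i<d. A i * a (n + i)))"
    unfolding nlrs_def by blast
  define B where "B = monom 1 d + (\<Sum>i<d. monom (A i) i)"
  have c: "coeff B i = (if i = d then 1 else if i < d then A i else 0)" for i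
    by (auto simp: B_def coeff_sum)
  have deg: "degree B = d"
    by (rule antisym) (auto intro!: degree_le le_degree simp: c)
  have "shift_eval B a = (\<lambda>n. a (n + d) + (\<Sum>i<d. A i * a (n + i)))"
    by (rule ext) (simp add: shift_eval_split deg c)
  with bd have "B \<in> nlrs_ideal a" by (simp add: nlrs_ideal_def)
  moreover have "lead_coeff B = 1" by (simp add: deg c)
  ultimately show "\<exists>B \<in> nlrs_ideal a. lead_coeff B = 1" by blast
next
  assume "\<exists>B \<in> nlrs_ideal a. lead_coeff B = 1"
  then obtain B where B: "Bseq (shift_eval B a)" "lead_coeff B = 1"
    by (auto simp: nlrs_ideal_def)
  have "shift_eval B a = (\<lambda>n. a (n + degree B) + (\<Sum>i<degree B. coeff B i * a (n + i)))"
    using B(2) by (intro ext) (simp add: shift_eval_split)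
  with B(1) have "Bseq (\<lambda>n. a (n + degree B) + (\<Sum>i<degree B. coeff B i * a (n + i)))"
    by simp
  then show "nlrs a"
    unfolding nlrs_def by (intro exI)
qed

lemma ex1_monic_generator:
  assumes "nlrs a"
  shows "\<exists>!P. is_monic_generator P (nlrs_ideal a)"
proof (rule ex_ex1I)
  obtain B where "B \<in> nlrs_ideal a \<and> lead_coeff B = 1"
    using assms nlrs_iff_monic by blast
  then obtain P where P: "P \<in> nlrs_ideal a" "lead_coeff P = 1"
    and least: "\<And>Q. Q \<in> nlrs_ideal a \<Longrightarrow> lead_coeff Q = 1 \<Longrightarrow> degree P \<le> degree Q"
    using ex_has_least_nat[of "\<lambda>Q. Q \<in> nlrs_ideal a \<and> lead_coeff Q = 1" B degree] by auto
  have "P dvd Q" if Q: "Q \<in> nlrs_ideal a" for Q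
  proof (rule ccontr)
    define R where "R = Q mod P"
    assume "\<not> P dvd Q"
    then have R0: "R \<noteq> 0" by (simp add: R_def mod_eq_0_iff_dvd)
    have "R = Q + (- (Q div P)) * P"
      unfolding R_def minus_div_mult_eq_mod[symmetric] by simp
    also have "\<dots> \<in> nlrs_ideal a"
      by (intro nlrs_ideal_add nlrs_ideal_mult P Q)
    finally have "R \<in> nlrs_ideal a" .
    then have "smult (inverse (lead_coeff R)) R \<in> nlrs_ideal a"
      by (rule nlrs_ideal_smult)
    then have "degree P \<le> degree R"
      using least[of "smult (inverse (lead_coeff R)) R"] R0 by simp
    moreover have "degree R < degree P"
      unfolding R_def
    proof (rule degree_mod_less')
      show "P \<noteq> 0" using P(2) by auto
    qed (use R0 in \<open>simp add: R_def\<close>)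
    ultimately show False by simp
  qed
  moreover have "Q \<in> nlrs_ideal a" if "P dvd Q" for Q
  proof -
    from that obtain C where "Q = P * C" by (rule dvdE)
    then show ?thesis using nlrs_ideal_mult[OF P(1), of C] by (simp add: mult.commute)
  qed
  ultimately have "nlrs_ideal a = {B. P dvd B}" by auto
  with P(2) show "\<exists>P. is_monic_generator P (nlrs_ideal a)"
    unfolding is_monic_generator_def by (intro exI conjI)
next
  fix P Q assume "is_monic_generator P (nlrs_ideal a)" "is_monic_generator Q (nlrs_ideal a)"
  then have lead: "lead_coeff P = 1" "lead_coeff Q = 1"
    and sets: "nlrs_ideal a = {B. P dvd B}" "nlrs_ideal a = {B. Q dvd B}"
    by (simp_all only: is_monic_generator_def)
  have dvd_iff: "P dvd B \<longleftrightarrow> Q dvd B" for B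
    using sets by (metis mem_Collect_eq)
  have PQ: "P dvd Q" "Q dvd P"
    using dvd_iff[of Q] dvd_iff[of P] by simp_all
  have nz: "P \<noteq> 0" "Q \<noteq> 0" using lead by auto
  obtain R where R: "Q = P * R" using PQ(1) by (rule dvdE)
  have "R \<noteq> 0" using R nz by auto
  moreover have "degree Q \<le> degree P" using PQ(2) nz(1) by (rule dvd_imp_degree_le)
  ultimately have "degree R = 0" using degree_mult_eq[OF nz(1), of R] R by simp
  then obtain c where c: "R = [:c:]" by (rule degree_eq_zeroE)
  then have "c = 1" using lead R \<open>R \<noteq> 0\<close> by simp
  then show "P = Q" using R c by simp
qed

lemma nlrs_char_poly:
  assumes "nlrs a"
  shows "lead_coeff (nlrs_char_poly a) = 1"
    and "nlrs_ideal a = {B. nlrs_char_poly a dvd B}"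
proof -
  have "is_monic_generator (nlrs_char_poly a) (nlrs_ideal a)"
    unfolding nlrs_char_poly_def using ex1_monic_generator[OF assms] by (rule theI')
  then show "lead_coeff (nlrs_char_poly a) = 1" "nlrs_ideal a = {B. nlrs_char_poly a dvd B}"
    by (simp_all only: is_monic_generator_def)
qed

text \<open>
  All zeros of the characteristic polynomial have modulus at least 1, so an ordering
  of its zeros into those outside and those on the unit circle always exists.
\<close>

lemma nlrs_char_poly_root_norm_ge_1:
  assumes "nlrs a" and root: "poly (nlrs_char_poly a) z = 0"
  shows "norm z \<ge> 1"
proof (rule ccontr)
  assume "\<not> norm z \<ge> 1"
  then have z: "norm z < 1" by simp
  let ?P = "nlrs_char_poly a"
  obtain Q where PQ: "?P = [:- z, 1:] * Q"
    using root by (auto simp: poly_eq_0_iff_dvd)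
  have P0: "?P \<noteq> 0" using nlrs_char_poly(1)[OF assms(1)] by auto
  have Q0: "Q \<noteq> 0" using P0 PQ by auto
  define b where "b = shift_eval Q a"
  have "?P \<in> nlrs_ideal a" using nlrs_char_poly(2)[OF assms(1)] by simp
  moreover have "shift_eval ?P a = (\<lambda>n. b (Suc n) - z * b n)"
  proof
    fix n
    have "?P = pCons 0 Q + smult (- z) Q" by (simp add: PQ)
    then show "shift_eval ?P a n = b (Suc n) - z * b n"
      by (simp add: shift_eval_add shift_eval_smult shift_eval_pCons_0 b_def del: smult_minus_left)
  qed
  ultimately have "Bseq (\<lambda>n. b (Suc n) - z * b n)" by (simp add: nlrs_ideal_def)
  then obtain K where K: "\<And>n. norm (b (Suc n) - z * b n) \<le> K"
    unfolding Bseq_def by blast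
  define M where "M = max (norm (b 0)) (K / (1 - norm z))"
  have KM: "K \<le> M * (1 - norm z)"
    using z by (simp add: M_def pos_divide_le_eq[symmetric])
  have "norm (b n) \<le> M" for n
  proof (induction n)
    case 0
    then show ?case by (simp add: M_def)
  next
    case (Suc n)
    have "norm (b (Suc n)) \<le> norm (b (Suc n) - z * b n) + norm (z * b n)"
      by (metis diff_add_cancel norm_triangle_ineq)
    also have "\<dots> \<le> K + norm z * M"
      using K Suc by (intro add_mono) (auto simp: norm_mult mult_left_mono)
    also have "\<dots> \<le> M" using KM by (simp add: algebra_simps)
    finally show ?case .
  qed
  then have "Bseq b" by (rule BseqI')
  then have "?P dvd Q"
    using nlrs_char_poly(2)[OF assms(1)] by (auto simp: nlrs_ideal_def b_def)
  then have "degree ?P \<le> degree Q" using Q0 by (rule dvd_imp_degree_le)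
  moreover have "degree ?P = Suc (degree Q)"
    using Q0 unfolding PQ by (subst degree_mult_eq) auto
  ultimately show False by simp
qed

text \<open>
  If the zeros are simple, every such linear recurrence sequence is a linear combination of the
  sequences of powers of the zeros.
\<close>

lemma shift_eval_sum: "shift_eval (\<Sum>j\<in>I. F j) s n = (\<Sum>j\<in>I. shift_eval (F j) s n)"
proof (induction I rule: infinite_finite_induct)
  case (insert x I)
  then show ?case by (simp add: shift_eval_add)
qed (simp_all add: shift_eval_def)

lemma shift_eval_mult_eq_0:
  assumes "\<And>n. shift_eval B s n = 0"
  shows "shift_eval (C * B) s n = 0"
proof (induction C arbitrary: n)
  case 0
  then show ?case by (simp add: shift_eval_def)
next
  case (pCons c C)
  then show ?case
    using assms by (simp add: shift_eval_add shift_eval_smult shift_eval_pCons_0)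
qed

lemma lrs_power_sum_exists:
  assumes monic: "lead_coeff P = 1" and bij: "bij_betw \<alpha> {1..degree P} {z. poly P z = 0}"
  shows "\<exists>g. \<forall>n. lrs P u n = (\<Sum>j=1..degree P. g j * \<alpha> j ^ n)"
proof -
  define I where "I = {1..degree P}"
  define s where "s = lrs P u"
  define L where "L = (\<lambda>j. smult (inverse (\<Prod>i\<in>I-{j}. \<alpha> j - \<alpha> i)) (\<Prod>i\<in>I-{j}. [:- \<alpha> i, 1:]))"
  have P0: "P \<noteq> 0" using monic by auto
  have inj: "inj_on \<alpha> I" and img: "\<alpha> ` I = {z. poly P z = 0}"
    using bij by (auto simp: bij_betw_def I_def)
  have fin: "finite I" by (simp add: I_def)
  have s0: "shift_eval P s n = 0" for n
    using lrs_rec[of P u n] monic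
    by (simp add: shift_eval_split s_def)
  have L: "poly (L j) (\<alpha> k) = (if k = j then 1 else 0)" if "j \<in> I" "k \<in> I" for j k
  proof (cases "k = j")
    case True
    have "(\<Prod>i\<in>I-{j}. \<alpha> j - \<alpha> i) \<noteq> 0"
      using that inj fin by (auto dest: inj_onD)
    with True show ?thesis by (simp add: L_def poly_prod)
  next
    case False
    then have "(\<Prod>i\<in>I-{j}. \<alpha> k - \<alpha> i) = 0"
      using that fin by (intro prod_zero) auto
    with False show ?thesis by (simp add: L_def poly_prod)
  qed
  have "s n = (\<Sum>j\<in>I. shift_eval (L j) s 0 * \<alpha> j ^ n)" for n
  proof -
    define R where "R = monom 1 n + (\<Sum>j\<in>I. smult (- (\<alpha> j ^ n)) (L j))"
    have "poly R z = 0" if "poly P z = 0" for z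
    proof -
      have "z \<in> \<alpha> ` I" using that img by simp
      then obtain k where k: "k \<in> I" "z = \<alpha> k" by (rule imageE)
      have "(\<Sum>j\<in>I. \<alpha> j ^ n * poly (L j) z) = (\<Sum>j\<in>I. if k = j then \<alpha> j ^ n else 0)"
        by (rule sum.cong) (auto simp: k L)
      also have "\<dots> = z ^ n" using k fin by simp
      finally show ?thesis
        by (simp add: R_def poly_sum poly_monom sum_negf)
    qed
    then have roots: "{z. poly P z = 0} \<subseteq> {z. poly (R mod P) z = 0}"
      by (auto simp: minus_div_mult_eq_mod[symmetric])
    have "R mod P = 0"
    proof (rule ccontr)
      assume R0: "R mod P \<noteq> 0"
      have "degree P = card {z. poly P z = 0}"
        using bij_betw_same_card[OF bij] by simp
      also have "\<dots> \<le> card {z. poly (R mod P) z = 0}"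
        using roots R0 by (intro card_mono poly_roots_finite)
      also have "\<dots> \<le> degree (R mod P)"
        by (rule card_poly_roots_bound[OF R0])
      also have "\<dots> < degree P" by (rule degree_mod_less'[OF P0 R0])
      finally show False by simp
    qed
    then have "R = (R div P) * P"
      by (metis add.right_neutral div_mult_mod_eq)
    then have "shift_eval R s 0 = 0"
      using shift_eval_mult_eq_0[of P s "R div P" 0] s0 by simp
    moreover have "shift_eval (monom 1 n) s 0 = (\<Sum>i\<le>n. if i = n then s i else 0)"
      unfolding shift_eval_bound[OF degree_monom_le] by (intro sum.cong) auto
    ultimately show ?thesis
      by (simp add: R_def shift_eval_add shift_eval_sum shift_eval_smult sum_negf mult.commute
          del: smult_minus_left)
  qed
  then show ?thesis unfolding s_def I_def by (intro exI allI)
qed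

end

theory Submission
  imports Defs
begin

text \<open>
  With \<open>f\<^sub>m = e\<^sub>d\<^sub>+\<^sub>m\<close> one has \<open>a\<^sub>n = \<Sum>\<^sub>j (gt\<^sub>j \<alpha>\<^sub>j\<^sup>n + gh\<^sub>j v\<^sub>j(n))\<close>, where
  \<open>v\<^sub>j(n) = \<Sum>m<n. f\<^sub>m \<alpha>\<^sub>j\<^sup>n\<^sup>-\<^sup>1\<^sup>-\<^sup>m\<close>. As \<open>f\<close> is bounded, \<open>v\<^sub>j(n) = O(n)\<close> if \<open>|\<alpha>\<^sub>j| = 1\<close>, and
  \<open>v\<^sub>j(n) = c(\<alpha>\<^sub>j) \<alpha>\<^sub>j\<^sup>n + O(1)\<close> if \<open>|\<alpha>\<^sub>j| > 1\<close>.
  For the nonvanishing, apply \<open>Q = P / (x - \<alpha>\<^sub>i)\<close> as a polynomial in the shift operator: this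
  maps \<open>v\<^sub>j\<close> to \<open>Q(\<alpha>\<^sub>j) v\<^sub>j + O(1)\<close> and so leaves
  \<open>Q(\<alpha>\<^sub>i) (gt\<^sub>i + gh\<^sub>i c(\<alpha>\<^sub>i)) \<alpha>\<^sub>i\<^sup>n + O(1)\<close>. If the coefficient vanished, \<open>Q\<close> would be in the
  ideal generated by \<open>P\<close>.
\<close>

section \<open>Convolution with powers\<close>

text \<open>The response, from initial value 0, of the first-order recurrence with multiplier
  \<open>z\<close> to the forcing \<open>f\<close>.\<close>

definition geom_conv :: "(nat \<Rightarrow> complex) \<Rightarrow> complex \<Rightarrow> nat \<Rightarrow> complex" where
  "geom_conv f z n = (\<Sum>m<n. f m * z ^ (n - Suc m))"

lemma geom_conv_0 [simp]: "geom_conv f z 0 = 0"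
  by (simp add: geom_conv_def)

lemma geom_conv_Suc: "geom_conv f z (Suc n) = z * geom_conv f z n + f n"
proof -
  have "(\<Sum>m<n. f m * z ^ (n - m)) = (\<Sum>m<n. z * (f m * z ^ (n - Suc m)))"
    by (intro sum.cong) (auto simp flip: power_Suc simp: Suc_diff_Suc)
  then show ?thesis
    by (simp add: geom_conv_def sum_distrib_left)
qed

text \<open>Restarting at time \<open>n\<close>: the value reached so far gains a factor
  \<open>z\<close> at each of the \<open>i\<close> further steps, while the later forcing acts from
  zero.\<close>

lemma geom_conv_add:
  "geom_conv f z (n + i) = z ^ i * geom_conv f z n + geom_conv (\<lambda>k. f (n + k)) z i"
  by (induction i) (simp_all add: geom_conv_Suc algebra_simps)

lemma norm_geom_conv_le:
  assumes "\<And>m. norm (f m) \<le> K"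
  shows "norm (geom_conv f z n) \<le> K * (\<Sum>m<n. norm z ^ m)"
proof -
  have "norm (geom_conv f z n) \<le> (\<Sum>m<n. K * norm z ^ (n - Suc m))"
    unfolding geom_conv_def
    by (rule sum_norm_le) (simp add: norm_mult norm_power assms mult_right_mono)
  also have "\<dots> = K * (\<Sum>m<n. norm z ^ m)"
    by (subst sum.nat_diff_reindex) (simp add: sum_distrib_left)
  finally show ?thesis .
qed

section \<open>Polynomials in the shift operator\<close>

lemma shift_eval_power: "shift_eval B (\<lambda>n. z ^ n) n = poly B z * z ^ n"
  by (simp add: shift_eval_def poly_altdef power_add sum_distrib_left sum_distrib_right mult_ac)

text \<open>Each shift splits by \<open>geom_conv_add\<close>, and the free parts add up to the
  factor \<open>poly B z\<close>. The remainder sees only \<open>degree B\<close> values of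
  \<open>f\<close>, from index \<open>n\<close> on.\<close>

lemma shift_eval_geom_conv:
  "shift_eval B (geom_conv f z) n =
     poly B z * geom_conv f z n + shift_eval B (geom_conv (\<lambda>k. f (n + k)) z) 0"
  by (simp add: shift_eval_def geom_conv_add[of f z n] poly_altdef sum_distrib_left
      sum_distrib_right distrib_left sum.distrib mult_ac)

lemma shift_eval_add_seq:
  "shift_eval B (\<lambda>n. s n + t n) n = shift_eval B s n + shift_eval B t n"
  by (simp add: shift_eval_def algebra_simps sum.distrib)

lemma shift_eval_mult_seq: "shift_eval B (\<lambda>n. c * s n) n = c * shift_eval B s n"
  by (simp add: shift_eval_def sum_distrib_left mult_ac)

lemma shift_eval_sum_seq:
  "shift_eval B (\<lambda>n. \<Sum>j\<in>I. s j n) n = (\<Sum>j\<in>I. shift_eval B (s j) n)"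
  by (simp add: shift_eval_def sum_distrib_left) (rule sum.swap)

text \<open>Only convolutions of length at most \<open>degree B\<close> occur, so the bound is
  uniform in \<open>n\<close> whatever the modulus of \<open>z\<close>.\<close>

lemma shift_eval_geom_conv_bounded:
  assumes "\<And>m. norm (f m) \<le> K"
  shows "\<exists>C. \<forall>n. norm (shift_eval B (geom_conv (\<lambda>k. f (n + k)) z) 0) \<le> C"
proof (intro exI allI)
  fix n
  show "norm (shift_eval B (geom_conv (\<lambda>k. f (n + k)) z) 0) \<le>
    (\<Sum>i\<le>degree B. norm (coeff B i) * (K * (\<Sum>m<i. norm z ^ m)))"
    unfolding shift_eval_def
    by (rule sum_norm_le)
      (use assms in \<open>auto simp: norm_mult intro!: mult_left_mono norm_geom_conv_le\<close>)
qed

section \<open>Growth of the convolution\<close>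

lemma geom_conv_unit_bigo:
  assumes "\<And>m. norm (f m) \<le> K" "norm z = 1"
  shows "geom_conv f z \<in> O(\<lambda>n. of_nat n)"
  by (rule bigoI[of _ K]) (use norm_geom_conv_le[of f K z] assms in auto)

text \<open>The convolution is \<open>z ^ n\<close> times a partial sum of the series. The missing
  tail times \<open>z ^ n\<close> is the same series for the forcing shifted by \<open>n\<close>,
  which a geometric series bounds independently of \<open>n\<close>.\<close>

lemma geom_conv_expanding_bounded:
  assumes f: "\<And>m. norm (f m) \<le> K" and z: "norm z > 1"
  shows "\<exists>C. \<forall>n. norm (geom_conv f z n - (\<Sum>m. f m * inverse z ^ Suc m) * z ^ n) \<le> C"
proof (intro exI allI)
  fix n
  define g where "g = (\<lambda>n m. f (n + m) * inverse z ^ Suc m)"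
  define h where "h = (\<lambda>m. K * norm (inverse z) ^ Suc m)"
  have z0: "z \<noteq> 0" using z by auto
  have "norm (inverse z) < 1"
    using z by (simp add: norm_inverse inverse_less_1_iff)
  then have sh: "summable h"
    unfolding h_def power_Suc by (intro summable_mult summable_geometric) simp
  have gh: "norm (g n m) \<le> h m" for n m
    unfolding g_def h_def norm_mult norm_power by (intro mult_right_mono f) simp
  have sg: "summable (g n)" for n
    by (rule summable_comparison_test'[OF sh]) (rule gh)
  have "(\<Sum>m. g 0 m) = (\<Sum>m. g 0 (m + n)) + (\<Sum>m<n. g 0 m)"
    by (rule suminf_split_initial_segment[OF sg])
  moreover have "(\<Sum>m<n. g 0 m) * z ^ n = geom_conv f z n"
    unfolding geom_conv_def sum_distrib_right
  proof (rule sum.cong)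
    fix m assume "m \<in> {..<n}"
    then have "Suc m + (n - Suc m) = n"
      by simp
    then have "z ^ n = z ^ Suc m * z ^ (n - Suc m)"
      by (metis power_add)
    then show "g 0 m * z ^ n = f m * z ^ (n - Suc m)"
      using z0 by (simp add: g_def field_simps)
  qed simp
  moreover have "(\<Sum>m. g 0 (m + n)) * z ^ n = (\<Sum>m. g n m)"
  proof -
    have "g 0 (m + n) * z ^ n = g n m" for m
      using z0 by (simp add: g_def power_add field_simps)
    moreover have "summable (\<lambda>m. g 0 (m + n))"
      using sg[of 0] by (rule summable_ignore_initial_segment)
    ultimately show ?thesis
      by (simp add: suminf_mult2)
  qed
  ultimately have "geom_conv f z n - (\<Sum>m. g 0 m) * z ^ n = - (\<Sum>m. g n m)"
    by (simp add: distrib_right)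
  moreover have "norm (\<Sum>m. g n m) \<le> suminf h"
    by (rule norm_suminf_le[OF gh sh])
  ultimately show "norm (geom_conv f z n - (\<Sum>m. f m * inverse z ^ Suc m) * z ^ n) \<le> suminf h"
    by (simp add: g_def)
qed

section \<open>Representation of the sequence by powers and convolutions\<close>

lemma seq_eq_if_shift_eval_eq:
  assumes monic: "lead_coeff P = 1"
    and init: "\<And>n. n < degree P \<Longrightarrow> s n = t n"
    and rec: "\<And>n. shift_eval P s n = shift_eval P t n"
  shows "s = t"
proof
  fix n
  show "s n = t n"
  proof (induction n rule: less_induct)
    case (less n)
    show ?case
    proof (cases "n < degree P")
      case False
      then obtain m where m: "n = m + degree P"
        by (metis add.commute le_Suc_ex not_less)
      have "(\<Sum>i<degree P. coeff P i * s (m + i)) = (\<Sum>i<degree P. coeff P i * t (m + i))"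
        by (intro sum.cong) (auto simp: m less)
      with rec[of m] monic show ?thesis
        by (simp add: shift_eval_split m)
    qed (rule init)
  qed
qed

lemma error_seq_shift_eval:
  assumes "nlrs a"
  shows "error_seq a (degree (nlrs_char_poly a) + n) = shift_eval (nlrs_char_poly a) a n"
  using nlrs_char_poly(1)[OF assms] by (simp add: error_seq_def Let_def shift_eval_split add.commute)

text \<open>Variation of constants: \<open>hat_seq\<close> is the impulse response of the
  recurrence, so convolving it with the error gives the solution with zero initial values;
  \<open>tilde_seq\<close> supplies the initial values.\<close>

lemma nlrs_eq_power_sum_geom_conv:
  fixes a :: "nat \<Rightarrow> complex"
  defines "P \<equiv> nlrs_char_poly a"
  assumes "nlrs a" and d: "degree P > 0" and roots: "\<And>j. j \<in> I \<Longrightarrow> poly P (\<alpha> j) = 0"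
    and til: "\<And>n. tilde_seq a n = (\<Sum>j\<in>I. gt j * \<alpha> j ^ n)"
    and hat: "\<And>n. hat_seq a n = (\<Sum>j\<in>I. gh j * \<alpha> j ^ n)"
  shows "a n = (\<Sum>j\<in>I. gt j * \<alpha> j ^ n + gh j * geom_conv (shift_eval P a) (\<alpha> j) n)"
proof -
  define f where "f = shift_eval P a"
  \<comment> \<open>The forcing stays an argument because \<open>w_rec\<close> also needs
    \<open>w\<close> for shifted forcings.\<close>
  define w where "w = (\<lambda>f n. \<Sum>j\<in>I. gh j * geom_conv f (\<alpha> j) n)"
  have monic: "lead_coeff P = 1"
    unfolding P_def by (rule nlrs_char_poly(1)[OF \<open>nlrs a\<close>])
  have hat_init: "hat_seq a n = (if n = degree P - 1 then 1 else 0)" if "n < degree P" for n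
    using that by (simp add: hat_seq_def lrs_init P_def)
  have w_hat: "w f n = (\<Sum>m<n. f m * hat_seq a (n - Suc m))" for f n
    unfolding w_def geom_conv_def hat sum_distrib_left
    by (subst sum.swap) (simp add: mult_ac)
  \<comment> \<open>All indices \<open>n - Suc m\<close> lie below \<open>degree P - 1\<close>,
    where \<open>hat_seq\<close> vanishes.\<close>
  have w_init: "w f n = 0" if "n < degree P" for f n
    unfolding w_hat using that by (intro sum.neutral) (auto simp: hat_init)
  \<comment> \<open>Now the impulse at index \<open>degree P - 1\<close> is met exactly once, by
    \<open>m = 0\<close>.\<close>
  have w_degree: "w f (degree P) = f 0" for f
  proof -
    have "w f (degree P) = (\<Sum>m<degree P. if m = 0 then f m else 0)"
      unfolding w_hat by (intro sum.cong) (use d in \<open>auto simp: hat_init\<close>)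
    then show ?thesis using d by simp
  qed
  have w_rec: "shift_eval P (w f) n = f n" for n
  proof -
    \<comment> \<open>The factors \<open>poly P (\<alpha> j)\<close> vanish, which moves the
      evaluation to time 0; there \<open>w_init\<close> and \<open>w_degree\<close> leave only the
      leading term.\<close>
    have "shift_eval P (w f) n = shift_eval P (w (\<lambda>k. f (n + k))) 0"
      unfolding w_def shift_eval_sum_seq shift_eval_mult_seq
      by (intro sum.cong) (simp_all add: roots shift_eval_geom_conv[of P f])
    also have "\<dots> = f n"
      using monic by (simp add: shift_eval_split w_init w_degree)
    finally show ?thesis .
  qed
  have til_rec: "shift_eval P (tilde_seq a) n = 0" for n
    using lrs_rec[of P a n] monic by (simp add: shift_eval_split tilde_seq_def P_def)
  have "a = (\<lambda>n. tilde_seq a n + w f n)"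
    using monic
  proof (rule seq_eq_if_shift_eval_eq)
    show "a n = tilde_seq a n + w f n" if "n < degree P" for n
      using that w_init[OF that] by (simp add: tilde_seq_def lrs_init P_def)
  qed (simp add: shift_eval_add_seq til_rec w_rec flip: f_def)
  then have "a n = tilde_seq a n + w f n"
    by (rule fun_cong)
  then show ?thesis
    by (simp add: til w_def f_def sum.distrib)
qed

section \<open>Asymptotics and nonvanishing of the coefficients\<close>

theorem theorem1:
  fixes a :: "nat \<Rightarrow> complex"
    and P :: "complex poly"
    and d r1 r2 :: nat
    and \<alpha> gt gh :: "nat \<Rightarrow> complex"
  assumes "nlrs a"
    and "P = nlrs_char_poly a"
    and "d = degree P"
    and "rsquarefree P"
    and "bij_betw \<alpha> {1..d} {z. poly P z = 0}"
    and "r1 + r2 = d"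
    and "\<forall>i\<in>{1..r1}. \<forall>j\<in>{1..r1}. i \<le> j \<longrightarrow> cmod (\<alpha> i) \<ge> cmod (\<alpha> j)"
    and "\<forall>i\<in>{1..r1}. cmod (\<alpha> i) > 1"
    and "\<forall>i\<in>{r1+1..r1+r2}. cmod (\<alpha> i) = 1"
    and "\<forall>n. tilde_seq a n = (\<Sum>j=1..d. gt j * \<alpha> j ^ n)"
    and "\<forall>n. hat_seq a n = (\<Sum>j=1..d. gh j * \<alpha> j ^ n)"
  shows "(r1 > 0 \<and> r2 = 0 \<longrightarrow>
            (\<lambda>n. a n - (\<Sum>i=1..r1. (gt i + gh i * error_series a (\<alpha> i)) * \<alpha> i ^ n)) \<in> O(\<lambda>n. 1) \<and>
            (\<forall>i\<in>{1..r1}. gt i + gh i * error_series a (\<alpha> i) \<noteq> 0)) \<and>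
         (r1 > 0 \<and> r2 > 0 \<longrightarrow>
            (\<lambda>n. a n - (\<Sum>i=1..r1. (gt i + gh i * error_series a (\<alpha> i)) * \<alpha> i ^ n)) \<in> O(\<lambda>n. of_nat n) \<and>
            (\<forall>i\<in>{1..r1}. gt i + gh i * error_series a (\<alpha> i) \<noteq> 0)) \<and>
         (r1 = 0 \<and> r2 > 0 \<longrightarrow> a \<in> O(\<lambda>n. of_nat n))"
proof -
  define f where "f = shift_eval P a"
  define v where "v = (\<lambda>j. geom_conv f (\<alpha> j))"
  define c where "c = (\<lambda>i. error_series a (\<alpha> i))"
  have P: "P \<in> nlrs_ideal a" and monic: "lead_coeff P = 1"
    using nlrs_char_poly[OF assms(1)] assms(2) by auto
  have "Bseq f"
    using P by (simp add: f_def nlrs_ideal_def)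
  then obtain K where K: "\<And>m. norm (f m) \<le> K"
    unfolding Bseq_def by blast
  have c_eq: "c i = (\<Sum>m. f m * inverse (\<alpha> i) ^ Suc m)" for i
    by (simp add: c_def error_series_def error_seq_shift_eval[OF assms(1)] f_def assms(2))
  have root: "poly P (\<alpha> j) = 0" if "j \<in> {1..d}" for j
    using bij_betwE[OF assms(5)] that by auto
  have a_eq: "a n = (\<Sum>j=1..d. gt j * \<alpha> j ^ n + gh j * v j n)" if "d > 0" for n
    using nlrs_eq_power_sum_geom_conv[of a "{1..d}" \<alpha> gt gh n] assms(1,2,3,10,11) root that
    by (simp add: v_def f_def)
  have big: "\<exists>C. \<forall>n. norm (v i n - c i * \<alpha> i ^ n) \<le> C" if "i \<in> {1..r1}" for i
    using geom_conv_expanding_bounded[of f K "\<alpha> i"] K assms(8) that by (simp add: v_def c_eq)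

  \<comment> \<open>Outside the unit circle \<open>v i\<close> is compared with
    \<open>c i * \<alpha> i ^ n\<close>; the zeros on the circle go wholly into the
    remainder.\<close>
  have split: "a n - (\<Sum>i=1..r1. (gt i + gh i * c i) * \<alpha> i ^ n) =
      (\<Sum>i=1..r1. gh i * (v i n - c i * \<alpha> i ^ n)) +
      (\<Sum>j=r1+1..r1+r2. gt j * \<alpha> j ^ n + gh j * v j n)" if "d > 0" for n
  proof -
    have "a n = (\<Sum>j=1..r1. gt j * \<alpha> j ^ n + gh j * v j n) +
        (\<Sum>j=r1+1..r1+r2. gt j * \<alpha> j ^ n + gh j * v j n)"
      unfolding a_eq[OF that] assms(6)[symmetric] by (rule sum.ub_add_nat) simp
    then show ?thesis
      by (simp add: algebra_simps sum.distrib sum_subtractf)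
  qed
  have O1: "(\<lambda>n. \<Sum>i=1..r1. gh i * (v i n - c i * \<alpha> i ^ n)) \<in> O(\<lambda>n. 1 :: complex)"
  proof (rule big_sum_in_bigo)
    fix i assume "i \<in> {1..r1}"
    then obtain C where "\<And>n. norm (v i n - c i * \<alpha> i ^ n) \<le> C"
      using big by blast
    then have "(\<lambda>n. v i n - c i * \<alpha> i ^ n) \<in> O(\<lambda>n. 1 :: complex)"
      by (intro bigoI[of _ C]) simp
    then show "(\<lambda>n. gh i * (v i n - c i * \<alpha> i ^ n)) \<in> O(\<lambda>n. 1 :: complex)"
      by simp
  qed
  \<comment> \<open>At \<open>n = 0\<close> the right-hand side is 0, so the bound starts at
    1.\<close>
  have one_On: "(\<lambda>n. 1 :: complex) \<in> O(\<lambda>n. of_nat n)"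
    by (rule bigoI[of _ 1]) (auto intro!: eventually_sequentiallyI[of 1])
  have On: "(\<lambda>n. \<Sum>j=r1+1..r1+r2. gt j * \<alpha> j ^ n + gh j * v j n) \<in> O(\<lambda>n. of_nat n :: complex)"
  proof (rule big_sum_in_bigo)
    fix j assume "j \<in> {r1+1..r1+r2}"
    then have unit: "norm (\<alpha> j) = 1" using assms(9) by simp
    then have "(\<lambda>n. \<alpha> j ^ n) \<in> O(\<lambda>n. 1 :: complex)"
      by (intro bigoI[of _ 1]) (simp add: norm_power)
    then have "(\<lambda>n. \<alpha> j ^ n) \<in> O(\<lambda>n. of_nat n :: complex)"
      using one_On by (rule landau_o.big_trans)
    moreover have "v j \<in> O(\<lambda>n. of_nat n :: complex)"
      unfolding v_def using geom_conv_unit_bigo[OF K unit] .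
    ultimately show "(\<lambda>n. gt j * \<alpha> j ^ n + gh j * v j n) \<in> O(\<lambda>n. of_nat n :: complex)"
      by (intro sum_in_bigo) simp_all
  qed
  have main: "(\<lambda>n. a n - (\<Sum>i=1..r1. (gt i + gh i * c i) * \<alpha> i ^ n)) \<in> O(\<lambda>n. of_nat n)"
    if "d > 0"
    unfolding split[OF that] by (intro sum_in_bigo On landau_o.big_trans[OF O1 one_On])
  have main1: "(\<lambda>n. a n - (\<Sum>i=1..r1. (gt i + gh i * c i) * \<alpha> i ^ n)) \<in> O(\<lambda>n. 1)"
    if "d > 0" "r2 = 0"
    unfolding split[OF that(1)] using O1 that(2) by simp

  have nonzero: "gt i + gh i * c i \<noteq> 0" if i: "i \<in> {1..r1}" for i
  proof
    assume zero: "gt i + gh i * c i = 0"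
    have id: "i \<in> {1..d}" and d: "d > 0" using i assms(6) by auto
    obtain Q where Q: "P = [:- \<alpha> i, 1:] * Q"
      using root[OF id] by (auto simp: poly_eq_0_iff_dvd)
    have Q0: "Q \<noteq> 0" using Q monic by auto
    \<comment> \<open>Injectivity of \<alpha> makes every other zero of \<open>P\<close> a zero of
      the cofactor \<open>Q\<close>.\<close>
    have Q_root: "poly Q (\<alpha> j) = 0" if "j \<in> {1..d}" "j \<noteq> i" for j
      using root[OF that(1)] bij_betw_imp_inj_on[OF assms(5)] that id
      by (auto simp: Q dest: inj_onD)
    define R where "R = (\<lambda>j n. shift_eval Q (geom_conv (\<lambda>k. f (n + k)) (\<alpha> j)) 0)"
    have "\<forall>j. \<exists>C. \<forall>n. norm (R j n) \<le> C"
      unfolding R_def using shift_eval_geom_conv_bounded[of f K Q] K by blast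
    then obtain C where C: "\<And>j n. norm (R j n) \<le> C j"
      by metis
    obtain D where D: "\<And>n. norm (v i n - c i * \<alpha> i ^ n) \<le> D"
      using big[OF i] by blast
    \<comment> \<open>Only \<open>j = i\<close> survives the factors
      \<open>poly Q (\<alpha> j)\<close>, and the assumed vanishing turns \<open>gt i\<close> into
      \<open>- (gh i * c i)\<close>, which leaves a bounded difference.\<close>
    have Qa: "shift_eval Q a n = poly Q (\<alpha> i) * (gh i * (v i n - c i * \<alpha> i ^ n)) +
        (\<Sum>j=1..d. gh j * R j n)" for n
    proof -
      have "shift_eval Q a n = (\<Sum>j=1..d. poly Q (\<alpha> j) * (gt j * \<alpha> j ^ n + gh j * v j n))
          + (\<Sum>j=1..d. gh j * R j n)"
        unfolding a_eq[OF d, abs_def] shift_eval_sum_seq shift_eval_add_seq shift_eval_mult_seq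
          shift_eval_power v_def shift_eval_geom_conv[of Q f] R_def
        by (simp add: sum.distrib algebra_simps)
      also have "(\<Sum>j=1..d. poly Q (\<alpha> j) * (gt j * \<alpha> j ^ n + gh j * v j n)) =
          poly Q (\<alpha> i) * (gt i * \<alpha> i ^ n + gh i * v i n)"
        using id Q_root by (subst sum.remove[of _ i]) auto
      also have "gt i = - (gh i * c i)"
        using zero by (simp add: eq_neg_iff_add_eq_0)
      finally show ?thesis
        by (simp add: algebra_simps)
    qed
    have "norm (shift_eval Q a n) \<le>
        norm (poly Q (\<alpha> i)) * (norm (gh i) * D) + (\<Sum>j=1..d. norm (gh j) * C j)" for n
      unfolding Qa
      by (intro norm_triangle_mono sum_norm_le)
        (simp_all add: norm_mult mult_left_mono C D)
    then have "Bseq (shift_eval Q a)"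
      by (rule BseqI')
    \<comment> \<open>Boundedness puts \<open>Q\<close> into the ideal, although its degree is one
      less than that of the generator.\<close>
    then have "P dvd Q"
      using nlrs_char_poly(2)[OF assms(1)] assms(2) by (auto simp: nlrs_ideal_def)
    then have "degree P \<le> degree Q"
      using Q0 by (rule dvd_imp_degree_le)
    moreover have "degree P = Suc (degree Q)"
      using Q0 unfolding Q by (subst degree_mult_eq) auto
    ultimately show False by simp
  qed
  have main0: "a \<in> O(\<lambda>n. of_nat n)" if "d > 0" "r1 = 0"
    using main that by simp
  show ?thesis
    using main main1 main0 nonzero assms(6) unfolding c_def by auto
qed

end
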